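(* Let $q \ge 3$ and $d \ge 1$ be integers, and let $j$ be an integer with $d - \frac{d-1}{q} \le j \le d$. Then: (i) $K_j(1) \le K_j(i)$ for all integers $i$ with $0 \le i \le d$. (ii) $|K_j(i)| \le |K_j(1)|$ for all integers $i$ with $1 \le i \le d$, unless $(q,d,i,j) = (3,4,3,3)$.
   Context: For integers $q\ge 2$, $d\ge 1$ and $0\le i,j\le d$, $$K_j(i) = \sum_{h=0}^j (-1)^h (q-1)^{j-h} \binom{i}{h} \binom{d-i}{j-h}$$ (the dependence on $q$ and $d$ is suppressed). The numbers $K_j(i)$, $0\le i\le d$, are the eigenvalues of the graph $H(d,q,j)$ whose vertex set is $Q^d$ with $|Q|=q$, two vectors being adjacent when they differ in exactly $j$ coordinates. *)

theory Defs imports Complex_Main begin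

text \<open>The value $K_j(i)$ of the Krawtchouk polynomial with parameters $q$ and $d$, intended for
  $q \ge 2$ and $0 \le i, j \le d$, so that the truncated subtractions \<open>d - i\<close> and
  \<open>j - h\<close> on \<^typ>\<open>nat\<close> agree with those of the integers.\<close>

definition krawtchouk :: "nat \<Rightarrow> nat \<Rightarrow> nat \<Rightarrow> nat \<Rightarrow> int" where
  "krawtchouk q d j i =
     (\<Sum>h = 0..j. (-1) ^ h * (int q - 1) ^ (j - h) * int (i choose h) * int ((d - i) choose (j - h)))"

end

theory Submission imports Defs "HOL-Computational_Algebra.Polynomial" begin

text \<open>
  Put \<open>p = q - 1\<close>, \<open>m = d - j\<close> and \<open>t = d - q m = q j - p d\<close>; the hypothesis on \<open>j\<close> says \<open>t \<ge> 1\<close>.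
  The three-term recurrence
  \<open>p (d - i) K(i + 1) = - (t + (p - 1) i) K(i) - i K(i - 1)\<close> bounds \<open>\<bar>K(i + 1)\<bar>\<close> by the larger of
  \<open>\<bar>K(i)\<bar>\<close> and \<open>\<bar>K(i - 1)\<bar>\<close> as long as \<open>t + 2 p i \<le> p d\<close>, so \<open>\<bar>K(i)\<bar> \<le> \<bar>K(1)\<bar>\<close> propagates from
  \<open>i = 1, 2\<close> to \<open>t + 2 p (i - 1) \<le> p d\<close>. For larger \<open>i\<close> the trivial estimate
  \<open>\<bar>K(i)\<bar> \<le> p^(d - i) (d choose j)\<close> suffices, since \<open>d \<bar>K(1)\<bar> = t p^(j - 1) (d choose j)\<close>, except
  for ten pairs \<open>(d, j)\<close> with \<open>q = 3\<close>, which are computed with the recurrence.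
\<close>

section \<open>Generating function and three-term recurrence\<close>

lemma coeff_one_linear_power:
  fixes b :: "'a :: comm_semiring_1"
  shows "coeff ([:1, b:] ^ n) k = of_nat (n choose k) * b ^ k"
proof (cases "k \<le> n")
  case False
  then have "degree ([:1, b:] ^ n) < k"
    using degree_power_le[of "[:1, b:]" n] by (simp add: le_less_trans split: if_splits)
  then show ?thesis using False by (simp add: coeff_eq_0 binomial_eq_0)
qed (simp add: coeff_linear_poly_power)

text \<open>The defining sum is the Cauchy product of the two binomial expansions.\<close>

lemma krawtchouk_coeff:
  "krawtchouk q d j i = coeff ([:1, -1:] ^ i * [:1, int q - 1:] ^ (d - i)) j"
  unfolding krawtchouk_def coeff_mult atMost_atLeast0
  by (rule sum.cong) (auto simp: coeff_one_linear_power algebra_simps)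

text \<open>
  With \<open>X = 1 - z\<close>, \<open>Y = 1 + p z\<close> and \<open>P = X^i Y^(d - i)\<close>, this compares coefficients in the expression of
  \<open>(p + 1) z P'\<close> through \<open>X^(i + 1) Y^(d - i - 1)\<close>, \<open>P\<close> and \<open>X^(i - 1) Y^(d - i + 1)\<close>. For \<open>i = 0\<close> the last
  term is absent, and the truncated \<open>i - 1\<close> is harmless because of the factor \<open>i\<close>.
\<close>

lemma krawtchouk_recurrence:
  assumes "i < d"
  shows "(int q - 1) * int (d - i) * krawtchouk q d j (Suc i) =
    (int i + (int q - 1) * int (d - i) - int q * int j) * krawtchouk q d j i
      - int i * krawtchouk q d j (i - 1)"
proof -
  define p where "p = int q - 1"
  define X where "X = [:1, -1::int:]"
  define Y where "Y = [:1, p:]"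
  obtain b where b: "d - i = Suc b" using assms by (metis Suc_diff_Suc)
  have K: "krawtchouk q d j k = coeff (X ^ k * Y ^ (d - k)) j" for k
    by (simp add: krawtchouk_coeff X_def Y_def p_def)
  have dX: "pderiv X = [:-1:]" and dY: "pderiv Y = [:p:]"
    by (simp_all add: X_def Y_def pderiv_pCons)
  have coeff_z_pderiv: "coeff (pCons 0 (pderiv P)) j = int j * coeff P j" for P :: "int poly"
    by (cases j) (auto simp: coeff_pderiv)
  show ?thesis
  proof (cases i)
    case 0
    \<comment> \<open>This is \<open>Y - X = (p + 1) z\<close>, scaled by
      \<open>p * int (Suc b)\<close>.\<close>
    have "smult (p * int (Suc b)) X = smult (p * int (Suc b)) Y
        - smult (p + 1) (pCons 0 [:p * int (Suc b):])"
      by (simp add: X_def Y_def algebra_simps)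
    then have "Y ^ b * smult (p * int (Suc b)) X = Y ^ b * (smult (p * int (Suc b)) Y
        - smult (p + 1) (pCons 0 [:p * int (Suc b):]))" by simp
    moreover have "pderiv (Y ^ Suc b) = Y ^ b * [:p * int (Suc b):]"
      unfolding pderiv_power_Suc dY by (simp add: algebra_simps)
    ultimately have "smult (p * int (Suc b)) (X * Y ^ b) = smult (p * int (Suc b)) (Y ^ Suc b)
        - smult (p + 1) (pCons 0 (pderiv (Y ^ Suc b)))"
      by (simp only: right_diff_distrib mult_smult_right mult_pCons_right)
        (simp add: algebra_simps)
    then have "coeff (smult (p * int (Suc b)) (X * Y ^ b)) j = coeff (smult (p * int (Suc b)) (Y ^ Suc b)
        - smult (p + 1) (pCons 0 (pderiv (Y ^ Suc b)))) j" by simp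
    moreover have "krawtchouk q d j 0 = coeff (Y ^ Suc b) j"
      "krawtchouk q d j (Suc 0) = coeff (X * Y ^ b) j"
      using K[of 0] K[of "Suc 0"] b 0 by simp_all
    ultimately show ?thesis
      unfolding coeff_diff coeff_smult coeff_z_pderiv using b 0
      by (simp add: algebra_simps p_def)
  next
    case (Suc a)
    define A where "A = X ^ a * Y ^ b"
    have "pderiv (X ^ Suc a * Y ^ Suc b) =
        A * (X * [:p * int (Suc b):] - Y * [:int (Suc a):])"
      unfolding pderiv_mult pderiv_power_Suc dX dY A_def
      by (simp add: algebra_simps)
    \<comment> \<open>Again only \<open>Y - X = (p + 1) z\<close>: substituting it makes both sides
      agree as quadratic forms in \<open>X\<close> and \<open>Y\<close>.\<close>
    moreover have "smult (p * int (Suc b)) (X * X) =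
        smult (int (Suc a) + p * int (Suc b)) (X * Y)
        - smult (p + 1) (pCons 0 (X * [:p * int (Suc b):] - Y * [:int (Suc a):]))
        - smult (int (Suc a)) (Y * Y)"
      by (simp add: X_def Y_def algebra_simps)
    then have "A * smult (p * int (Suc b)) (X * X) =
        A * (smult (int (Suc a) + p * int (Suc b)) (X * Y)
        - smult (p + 1) (pCons 0 (X * [:p * int (Suc b):] - Y * [:int (Suc a):]))
        - smult (int (Suc a)) (Y * Y))" by simp
    ultimately have "smult (p * int (Suc b)) (X ^ Suc (Suc a) * Y ^ b) =
        smult (int (Suc a) + p * int (Suc b)) (X ^ Suc a * Y ^ Suc b)
        - smult (p + 1) (pCons 0 (pderiv (X ^ Suc a * Y ^ Suc b)))
        - smult (int (Suc a)) (X ^ a * Y ^ Suc (Suc b))"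
      by (simp only: right_diff_distrib mult_smult_right mult_pCons_right)
        (simp add: A_def algebra_simps)
    then have "coeff (smult (p * int (Suc b)) (X ^ Suc (Suc a) * Y ^ b)) j = coeff (
        smult (int (Suc a) + p * int (Suc b)) (X ^ Suc a * Y ^ Suc b)
        - smult (p + 1) (pCons 0 (pderiv (X ^ Suc a * Y ^ Suc b)))
        - smult (int (Suc a)) (X ^ a * Y ^ Suc (Suc b))) j" by (rule arg_cong)
    moreover have "d - a = Suc (Suc b)" "d - Suc (Suc a) = b" using b Suc by auto
    ultimately show ?thesis
      unfolding coeff_diff coeff_smult coeff_z_pderiv using b Suc
      by (simp add: K algebra_simps p_def)
  qed
qed

section \<open>The trivial estimate and the value at \<open>0\<close>\<close>

text \<open>Nonzero summands have \<open>j - h \<le> d - i\<close>, which caps the power of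
  \<open>q - 1\<close>; Vandermonde's identity adds up the binomial products.\<close>

lemma abs_krawtchouk_le_binomial:
  assumes "i \<le> d" "q \<ge> 2"
  shows "\<bar>krawtchouk q d j i\<bar> \<le> (int q - 1) ^ (d - i) * int (d choose j)"
proof -
  let ?p = "int q - 1"
  have "\<bar>krawtchouk q d j i\<bar> \<le>
      (\<Sum>h = 0..j. \<bar>(-1) ^ h * ?p ^ (j - h) * int (i choose h) * int ((d - i) choose (j - h))\<bar>)"
    unfolding krawtchouk_def by (rule sum_abs)
  also have "\<dots> \<le> (\<Sum>h = 0..j. ?p ^ (d - i) * int ((i choose h) * ((d - i) choose (j - h))))"
  proof (rule sum_mono)
    fix h
    show "\<bar>(-1) ^ h * ?p ^ (j - h) * int (i choose h) * int ((d - i) choose (j - h))\<bar>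
        \<le> ?p ^ (d - i) * int ((i choose h) * ((d - i) choose (j - h)))"
    proof (cases "j - h \<le> d - i")
      case True
      then have "?p ^ (j - h) \<le> ?p ^ (d - i)" using assms by (intro power_increasing) auto
      then show ?thesis using assms by (auto simp: abs_mult power_abs mult.assoc intro!: mult_right_mono)
    qed (simp add: binomial_eq_0)
  qed
  also have "\<dots> = ?p ^ (d - i) * int (\<Sum>h = 0..j. (i choose h) * ((d - i) choose (j - h)))"
    by (simp add: sum_distrib_left)
  also have "(\<Sum>h = 0..j. (i choose h) * ((d - i) choose (j - h))) = d choose j"
    using vandermonde[of i "d - i" j] assms by (simp add: atMost_atLeast0)
  finally show ?thesis .
qed

lemma krawtchouk_at_0: "krawtchouk q d j 0 = (int q - 1) ^ j * int (d choose j)"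
proof -
  have "krawtchouk q d j 0 = (\<Sum>h\<in>{0}. (-1) ^ h * (int q - 1) ^ (j - h) *
      int (0 choose h) * int ((d - 0) choose (j - h)))"
    unfolding krawtchouk_def by (rule sum.mono_neutral_right) (auto simp: binomial_eq_0)
  then show ?thesis by simp
qed

section \<open>Exponential against linear growth\<close>

text \<open>To be read with \<open>t + (p + 1) * m = d\<close> and \<open>e + m = i - 1\<close>:
  where the recurrence argument stops, the trivial estimate takes over. The hypothesis forces
  \<open>d < 4 e\<close>, and \<open>4 e \<le> 3 ^ e + 1\<close>.\<close>

lemma power_dominates_large_base:
  fixes p t m :: int and e :: nat
  assumes "p \<ge> 3" "t \<ge> 1" "m \<ge> 0"
    and less: "p * (t + (p + 1) * m) < t + 2 * p * (int e + m)"
  shows "t + (p + 1) * m \<le> p ^ e * t"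
proof -
  have "(p - 1) * (t + p * m) < 2 * p * int e"
    using less by (simp add: algebra_simps)
  then have "(p + 1) * ((p - 1) * (t + p * m)) < (p + 1) * (2 * p * int e)"
    using assms by simp
  moreover have "p * (p - 1) * (t + (p + 1) * m) \<le> (p + 1) * ((p - 1) * (t + p * m))"
    using assms by (simp add: algebra_simps)
  \<comment> \<open>\<open>p + 1 \<le> 2 * (p - 1)\<close> is where \<open>p \<ge> 3\<close>
    enters.\<close>
  moreover have "(p + 1) * (2 * p * int e) \<le> (2 * (p - 1)) * (2 * p * int e)"
    using assms by (intro mult_right_mono) auto
  ultimately have "p * (p - 1) * (t + (p + 1) * m) < p * (p - 1) * (4 * int e)"
    by (simp add: algebra_simps)
  moreover have "p * (p - 1) > 0" using assms by simp
  \<comment> \<open>The \<open>- 1\<close> gained from integrality matters: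
    \<open>4 e = 3 ^ e + 1\<close> at \<open>e = 1\<close>.\<close>
  ultimately have d: "t + (p + 1) * m \<le> 4 * int e - 1"
    by (simp add: mult_less_cancel_left_pos)
  moreover have "4 * int e \<le> 3 ^ e + 1"
  proof (induction e)
    case (Suc e)
    have "(3::int) ^ e \<ge> 1" by simp
    then show ?case using Suc by (cases e) auto
  qed simp
  moreover have "(3::int) ^ e \<le> p ^ e" using assms by (intro power_mono) auto
  moreover have "p ^ e * 1 \<le> p ^ e * t" using assms by (intro mult_left_mono) auto
  ultimately show ?thesis by linarith
qed

text \<open>The hypothesis amounts to \<open>t + 2 m < 4 e\<close>, so
  \<open>t + 3 m \<le> 6 e\<close>. As \<open>6 e \<le> 2 ^ e\<close> starts at
  \<open>e = 5\<close>, smaller \<open>e\<close> are treated one by one and leave the listed pairs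
  \<open>(t, m)\<close>.\<close>

lemma power_dominates_base_2:
  fixes t m :: int and e :: nat
  assumes "t \<ge> 1" "m \<ge> 0" and less: "2 * (t + 3 * m) < t + 4 * (int e + m)"
  shows "t + 3 * m \<le> 2 ^ e * t \<or> t = 1 \<and> m \<le> 7 \<or> t = 2 \<and> (m = 1 \<or> m = 2)"
proof (cases "e \<le> 4")
  case True
  then have "e = 0 \<or> e = 1 \<or> e = 2 \<or> e = 3 \<or> e = 4" by auto
  then show ?thesis using assms by (elim disjE; simp; presburger)
next
  case False
  then have "5 \<le> e" by simp
  then have "12 * int e \<le> 2 * 2 ^ e"
    by (induction e rule: dec_induct) auto
  then have "6 * int e \<le> 2 ^ e * 1" by linarith
  also have "(2::int) ^ e * 1 \<le> 2 ^ e * t" using assms by (intro mult_left_mono) auto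
  finally have "6 * int e \<le> 2 ^ e * t" .
  moreover have "t + 3 * m \<le> 6 * int e" using less assms(1) by (simp add: algebra_simps)
  ultimately show ?thesis by linarith
qed

section \<open>Sign of \<open>K(0)\<close> and the ratio of \<open>K(1)\<close> to
  \<open>K(0)\<close>\<close>

lemma krawtchouk_at_0_pos:
  assumes "q \<ge> 2" "j \<le> d"
  shows "krawtchouk q d j 0 > 0"
  using assms by (simp add: krawtchouk_at_0)

lemma krawtchouk_1_eq:
  assumes "d \<ge> 1"
  shows "(int q - 1) * int d * krawtchouk q d j 1 =
    ((int q - 1) * int d - int q * int j) * krawtchouk q d j 0"
  using krawtchouk_recurrence[of 0 d q j] assms by simp

section \<open>Computation of the small ternary cases\<close>

text \<open>
  Runs the recurrence for \<open>q = 3\<close> without division: \<open>x\<close>, \<open>y\<close>, \<open>b\<close> are \<open>K(i - 1)\<close>, \<open>K(i)\<close>, \<open>\<bar>K(1)\<bar>\<close> up to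
  a common positive factor, \<open>n = d - i\<close> and \<open>t = 3 j - 2 d\<close>. The exempted triple \<open>(n, t, i) = (1, 1, 3)\<close>
  encodes \<open>(d, i, j) = (4, 3, 3)\<close>.
\<close>

fun ternary_check :: "nat \<Rightarrow> int \<Rightarrow> nat \<Rightarrow> int \<Rightarrow> int \<Rightarrow> int \<Rightarrow> bool" where
  "ternary_check n t i x y b \<longleftrightarrow> (\<bar>y\<bar> \<le> b \<or> n = 1 \<and> t = 1 \<and> i = 3) \<and>
     (case n of 0 \<Rightarrow> True
      | Suc r \<Rightarrow> ternary_check r t (Suc i) (2 * int n * y) (- (t + int i) * y - int i * x) (2 * int n * b))"

declare ternary_check.simps [simp del]

lemma abs_le_rescale:
  fixes c s :: int
  assumes "c > 0" "s > 0" "c * y = s * u" "c * b = s * v" "\<bar>y\<bar> \<le> b"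
  shows "\<bar>u\<bar> \<le> v"
proof -
  have "s * \<bar>u\<bar> = c * \<bar>y\<bar>" using arg_cong[OF assms(3), of abs] assms(1,2) by (simp add: abs_mult)
  also have "\<dots> \<le> s * v" using assms by (simp flip: assms(4))
  finally show ?thesis using assms(2) by simp
qed

text \<open>The positive factors \<open>c\<close> and \<open>s\<close> express proportionality to
  the true values. Along the run \<open>c\<close> is fixed, while \<open>s\<close> picks up the
  leading coefficient \<open>2 (d - i)\<close> of the recurrence at each step.\<close>

lemma ternary_check_sound:
  assumes "ternary_check n (3 * int j - 2 * int d) i x y b" "c > 0" "s > 0" "d = i + n"
    and "c * x = s * krawtchouk 3 d j (i - 1)" "c * y = s * krawtchouk 3 d j i"
    and "c * b = s * \<bar>krawtchouk 3 d j 1\<bar>" "i \<le> k" "k \<le> d" "(d, k, j) \<noteq> (4, 3, 3)"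
  shows "\<bar>krawtchouk 3 d j k\<bar> \<le> \<bar>krawtchouk 3 d j 1\<bar>"
  using assms
proof (induction n arbitrary: i x y b s)
  case (0 i x y b s)
  then have "k = i" by simp
  from 0 have "\<bar>y\<bar> \<le> b" by (subst (asm) ternary_check.simps) simp
  then show ?case using abs_le_rescale[OF 0(2,3,6,7)] \<open>k = i\<close> by simp
next
  case (Suc n i x y b s)
  let ?t = "3 * int j - 2 * int d"
  show ?case
  proof (cases "k = i")
    case True
    have "\<not> (Suc n = 1 \<and> ?t = 1 \<and> i = 3)" using Suc.prems True by auto
    then have "\<bar>y\<bar> \<le> b" using Suc.prems(1) by (subst (asm) ternary_check.simps) auto
    then show ?thesis using abs_le_rescale[OF Suc.prems(2,3,6,7)] True by simp
  next
    case False
    have "2 * int (Suc n) * krawtchouk 3 d j (Suc i) =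
        - (?t + int i) * krawtchouk 3 d j i - int i * krawtchouk 3 d j (i - 1)"
      using krawtchouk_recurrence[of i d 3 j] Suc.prems(4) by (simp add: algebra_simps)
    then have "s * (2 * int (Suc n) * krawtchouk 3 d j (Suc i)) =
        - (?t + int i) * (s * krawtchouk 3 d j i) - int i * (s * krawtchouk 3 d j (i - 1))"
      by (simp only: right_diff_distrib mult.left_commute)
    also have "\<dots> = c * (- (?t + int i) * y - int i * x)"
      unfolding Suc.prems(5,6)[symmetric] by (simp add: algebra_simps)
    finally have next_val: "c * (- (?t + int i) * y - int i * x) =
        s * (2 * int (Suc n)) * krawtchouk 3 d j (Suc i)" by simp
    show ?thesis
    proof (rule Suc.IH)
      show "ternary_check n ?t (Suc i) (2 * int (Suc n) * y) (- (?t + int i) * y - int i * x)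
          (2 * int (Suc n) * b)"
        using Suc.prems(1) by (subst (asm) ternary_check.simps) auto
      show "c * (- (?t + int i) * y - int i * x) =
        s * (2 * int (Suc n)) * krawtchouk 3 d j (Suc i)" by (fact next_val)
      show "c * (2 * int (Suc n) * y) = s * (2 * int (Suc n)) * krawtchouk 3 d j (Suc i - 1)"
        unfolding diff_Suc_1 using Suc.prems(6) by algebra
      show "c * (2 * int (Suc n) * b) = s * (2 * int (Suc n)) * \<bar>krawtchouk 3 d j 1\<bar>"
        using Suc.prems(7) by algebra
    qed (use Suc.prems False in auto)
  qed
qed

text \<open>The pairs are \<open>(t + 3 m, t + 2 m)\<close> for the \<open>(t, m)\<close> left over
  by \<open>power_dominates_base_2\<close>.\<close>

lemma krawtchouk_ternary_small_cases:
  assumes "(d, j) \<in> {(1,1),(4,3),(7,5),(10,7),(13,9),(16,11),(19,13),(22,15),(5,4),(8,6)}"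
    and "1 \<le> i" "i \<le> d" "(d, i, j) \<noteq> (4, 3, 3)"
  shows "\<bar>krawtchouk 3 d j i\<bar> \<le> \<bar>krawtchouk 3 d j 1\<bar>"
proof (rule ternary_check_sound)
  let ?t = "3 * int j - 2 * int d"
  \<comment> \<open>Each run starts at \<open>i = 1\<close> with \<open>2 d\<close>,
    \<open>- t\<close>, \<open>t\<close> for \<open>K(0)\<close>, \<open>K(1)\<close>,
    \<open>\<bar>K(1)\<bar>\<close>, because \<open>2 d K(1) = - t K(0)\<close>; thus
    \<open>c = K(0)\<close> and \<open>s = 2 d\<close>.\<close>
  have "ternary_check 0 1 1 2 (- 1) 1"
    "ternary_check 3 1 1 8 (- 1) 1"
    "ternary_check 6 1 1 14 (- 1) 1"
    "ternary_check 9 1 1 20 (- 1) 1"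
    "ternary_check 12 1 1 26 (- 1) 1"
    "ternary_check 15 1 1 32 (- 1) 1"
    "ternary_check 18 1 1 38 (- 1) 1"
    "ternary_check 21 1 1 44 (- 1) 1"
    "ternary_check 4 2 1 10 (- 2) 2"
    "ternary_check 7 2 1 16 (- 2) 2"
    by (simp_all add: ternary_check.simps eval_nat_numeral)
  then show "ternary_check (d - 1) ?t 1 (2 * int d) (- ?t) ?t" using assms(1) by auto
  show pos: "krawtchouk 3 d j 0 > 0"
    using assms(1) by (intro krawtchouk_at_0_pos) auto
  have "2 * int d * krawtchouk 3 d j 1 = - ?t * krawtchouk 3 d j 0"
    using krawtchouk_1_eq[of d 3 j] assms by simp
  then show K1: "krawtchouk 3 d j 0 * - ?t = 2 * int d * krawtchouk 3 d j 1"
    by simp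
  have "?t \<ge> 0" using assms(1) by auto
  then show "krawtchouk 3 d j 0 * ?t = 2 * int d * \<bar>krawtchouk 3 d j 1\<bar>"
    using arg_cong[OF K1, of abs] pos by (simp add: abs_mult)
qed (use assms in auto)

section \<open>Propagation of the bound by the recurrence\<close>

text \<open>The recurrence at \<open>1\<close> involves \<open>K(0)\<close>, which exceeds
  \<open>\<bar>K(1)\<bar>\<close>. Eliminating \<open>K(0)\<close> makes \<open>K(2)\<close> an
  explicit multiple of \<open>K(1)\<close>, and \<open>1 \<le> t \<le> d\<close> bounds the
  factor.\<close>

lemma abs_krawtchouk_2_le:
  assumes q: "q \<ge> 3" and "j \<le> d" "d \<ge> 2" and t: "t = int q * int j - (int q - 1) * int d" "t \<ge> 1"
  shows "\<bar>krawtchouk q d j 2\<bar> \<le> \<bar>krawtchouk q d j 1\<bar>"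
proof -
  define p D where "p = int q - 1" and "D = int d"
  have p: "p \<ge> 2" and D: "D \<ge> 2" using assms by (auto simp: p_def D_def)
  have "t \<le> D"
  proof -
    have "int q * int j \<le> int q * int d" using assms by simp
    then show ?thesis unfolding t D_def by (simp add: algebra_simps)
  qed
  have K1: "p * D * krawtchouk q d j 1 = - t * krawtchouk q d j 0"
    using krawtchouk_1_eq[of d q j] assms by (simp add: p_def D_def)
  have "p * (D - 1) * krawtchouk q d j 2 = - (t + p - 1) * krawtchouk q d j 1 - krawtchouk q d j 0"
    using krawtchouk_recurrence[of 1 d q j] assms(3) unfolding t(1)
    by (simp add: p_def D_def of_nat_diff numeral_2_eq_2 algebra_simps)
  then have "t * (p * (D - 1)) * krawtchouk q d j 2 =
      - (t + p - 1) * t * krawtchouk q d j 1 - t * krawtchouk q d j 0"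
    by algebra
  also have "\<dots> = (p * D - t * (t + p - 1)) * krawtchouk q d j 1"
    using K1 by algebra
  finally have eq: "t * (p * (D - 1)) * krawtchouk q d j 2 =
      (p * D - t * (t + p - 1)) * krawtchouk q d j 1" .
  have "p * D - t * (t + p - 1) \<le> t * (p * (D - 1))"
  proof -
    \<comment> \<open>The right side is the difference of the two sides, factored; the next block
      writes its difference as a sum of nonnegative terms.\<close>
    have "0 \<le> (t - 1) * (p * D + t)" using p D t by simp
    then show ?thesis by (simp add: algebra_simps)
  qed
  moreover have "- (p * D - t * (t + p - 1)) \<le> t * (p * (D - 1))"
  proof -
    have "0 \<le> t * ((p - 1) * (D - 1)) + t * (D - t) + p * (D - t)"
      using p D t \<open>t \<le> D\<close> by (intro add_nonneg_nonneg mult_nonneg_nonneg) auto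
    then show ?thesis by (simp add: algebra_simps)
  qed
  ultimately have "\<bar>p * D - t * (t + p - 1)\<bar> \<le> t * (p * (D - 1))" by linarith
  then have "\<bar>p * D - t * (t + p - 1)\<bar> * \<bar>krawtchouk q d j 1\<bar> \<le>
      t * (p * (D - 1)) * \<bar>krawtchouk q d j 1\<bar>" by (rule mult_right_mono) simp
  moreover have "\<bar>t * (p * (D - 1))\<bar> = t * (p * (D - 1))" using p D t by simp
  ultimately have "t * (p * (D - 1)) * \<bar>krawtchouk q d j 2\<bar> \<le> t * (p * (D - 1)) * \<bar>krawtchouk q d j 1\<bar>"
    using arg_cong[OF eq, of abs] unfolding abs_mult[of _ "krawtchouk _ _ _ _"] by metis
  moreover have "t * (p * (D - 1)) > 0" using p D t by simp
  ultimately show ?thesis by (rule mult_left_le_imp_le)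
qed

text \<open>With \<open>k = i - 1\<close>, the last hypothesis reads
  \<open>t + p k \<le> p (d - k)\<close>: the absolute coefficients of \<open>K(k)\<close> and
  \<open>K(k - 1)\<close> sum to at most that of \<open>K(i)\<close>. It passes to smaller indices,
  so strong induction applies.\<close>

lemma abs_krawtchouk_le_initial:
  assumes q: "q \<ge> 3" and "j \<le> d" and t: "t = int q * int j - (int q - 1) * int d" "t \<ge> 1"
    and "1 \<le> i" "i \<le> d" "t + 2 * (int q - 1) * (int i - 1) \<le> (int q - 1) * int d"
  shows "\<bar>krawtchouk q d j i\<bar> \<le> \<bar>krawtchouk q d j 1\<bar>"
  using assms(5-)
proof (induction i rule: less_induct)
  case (less i)
  define p where "p = int q - 1"
  have p: "p \<ge> 2" using q by (simp add: p_def)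
  consider "i = 1" | "i = 2" | "i \<ge> 3" using less.prems by linarith
  then show ?case
  proof cases
    case 2
    then show ?thesis using abs_krawtchouk_2_le[of q j d t] assms less.prems by simp
  next
    case 3
    define k where "k = i - 1"
    have k: "i = Suc k" "k \<ge> 2" "k < d" using 3 less.prems by (auto simp: k_def)
    define B where "B = \<bar>krawtchouk q d j 1\<bar>"
    have bound: "t + 2 * p * int k \<le> p * int d" using less.prems k by (simp add: p_def)
    have IH: "\<bar>krawtchouk q d j l\<bar> \<le> B" if "l \<in> {k, k - 1}" for l
      unfolding B_def
    proof (rule less.IH)
      show "l < i" "1 \<le> l" "l \<le> d" using that k by auto
      have "2 * p * (int l - 1) \<le> 2 * p * int k" using that p by (intro mult_left_mono) auto
      then show "t + 2 * (int q - 1) * (int l - 1) \<le> (int q - 1) * int d"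
        using bound unfolding p_def by linarith
    qed
    have pos: "p * int (d - k) > 0" using p k by simp
    have "p * int (d - k) * krawtchouk q d j i =
        - (t + (p - 1) * int k) * krawtchouk q d j k - int k * krawtchouk q d j (k - 1)"
      using krawtchouk_recurrence[of k d q j] k(3) unfolding k(1) t p_def
      by (simp add: of_nat_diff algebra_simps)
    then have "p * int (d - k) * \<bar>krawtchouk q d j i\<bar> =
        \<bar>- (t + (p - 1) * int k) * krawtchouk q d j k - int k * krawtchouk q d j (k - 1)\<bar>"
      using pos by (metis abs_mult abs_of_pos)
    also have "\<dots> \<le> \<bar>(t + (p - 1) * int k) * krawtchouk q d j k\<bar> + \<bar>int k * krawtchouk q d j (k - 1)\<bar>"
      by linarith
    also have "\<dots> = (t + (p - 1) * int k) * \<bar>krawtchouk q d j k\<bar> + int k * \<bar>krawtchouk q d j (k - 1)\<bar>"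
      using p t by (simp add: abs_mult)
    also have "\<dots> \<le> (t + (p - 1) * int k) * B + int k * B"
      using p t by (intro add_mono mult_left_mono IH) auto
    also have "\<dots> = (t + p * int k) * B" by (simp add: algebra_simps)
    also have "\<dots> \<le> p * int (d - k) * B"
      using bound k(3) by (intro mult_right_mono) (auto simp: B_def of_nat_diff algebra_simps)
    finally show ?thesis using pos unfolding B_def by (rule mult_left_le_imp_le)
  qed simp
qed

section \<open>Large \<open>i\<close> and the combined bound\<close>

text \<open>Since \<open>j - 1 = (d - i) + e\<close>, the exact value of
  \<open>d \<bar>K(1)\<bar>\<close> is \<open>p ^ e * t\<close> times the trivial estimate for
  \<open>\<bar>K(i)\<bar>\<close>.\<close>

lemma abs_krawtchouk_le_final:
  assumes q: "q \<ge> 3" and "j \<le> d" and t: "t = int q * int j - (int q - 1) * int d" "t \<ge> 1"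
    and "i \<le> d" "j = Suc (d - i + e)"
    and dom: "int d \<le> (int q - 1) ^ e * t"
  shows "\<bar>krawtchouk q d j i\<bar> \<le> \<bar>krawtchouk q d j 1\<bar>"
proof -
  define p where "p = int q - 1"
  have p: "p \<ge> 2" using q by (simp add: p_def)
  have d: "d \<ge> 1" using assms by simp
  have "p * int d * krawtchouk q d j 1 = - t * krawtchouk q d j 0"
    using krawtchouk_1_eq[of d q j] d t(1) by (simp add: p_def)
  also have "\<dots> = p * (- (t * (p ^ (d - i) * p ^ e * int (d choose j))))"
    by (simp add: krawtchouk_at_0 flip: p_def) (simp add: assms(6) power_add algebra_simps)
  finally have "int d * krawtchouk q d j 1 = - (t * (p ^ (d - i) * p ^ e * int (d choose j)))"
    using p unfolding mult.assoc[of p] by (subst (asm) mult_left_cancel) auto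
  from arg_cong[OF this, of abs]
  have K1: "int d * \<bar>krawtchouk q d j 1\<bar> = p ^ e * t * (p ^ (d - i) * int (d choose j))"
    using p t(2) by (simp add: abs_mult power_abs ac_simps)
  have "int d * \<bar>krawtchouk q d j i\<bar> \<le> int d * (p ^ (d - i) * int (d choose j))"
    using abs_krawtchouk_le_binomial[of i d q j] assms by (intro mult_left_mono) (auto simp: p_def)
  also have "\<dots> \<le> p ^ e * t * (p ^ (d - i) * int (d choose j))"
    using dom p by (intro mult_right_mono) (auto simp: p_def)
  finally have "int d * \<bar>krawtchouk q d j i\<bar> \<le> int d * \<bar>krawtchouk q d j 1\<bar>" unfolding K1 .
  then show ?thesis using d by simp
qed

lemma abs_krawtchouk_le:
  assumes q: "q \<ge> 3" and j: "j \<le> d" and t: "t = int q * int j - (int q - 1) * int d" "t \<ge> 1"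
    and i: "1 \<le> i" "i \<le> d" and exc: "(q, d, i, j) \<noteq> (3, 4, 3, 3)"
  shows "\<bar>krawtchouk q d j i\<bar> \<le> \<bar>krawtchouk q d j 1\<bar>"
proof (cases "t + 2 * (int q - 1) * (int i - 1) \<le> (int q - 1) * int d")
  case True
  then show ?thesis using abs_krawtchouk_le_initial assms by blast
next
  case False
  define p m where "p = int q - 1" and "m = int d - int j"
  have p: "p \<ge> 2" and m: "m \<ge> 0" using q j by (auto simp: p_def m_def)
  have d: "int d = t + (p + 1) * m" by (simp add: t p_def m_def algebra_simps)
  have less: "p * (t + (p + 1) * m) < t + 2 * p * (int i - 1)"
    using False unfolding d[symmetric] unfolding p_def by linarith
  have "0 < 2 * p * (int i - 1 - m)"
  proof -
    have "0 \<le> (p - 1) * (t + p * m)" using p t m by simp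
    then show ?thesis using less by (simp add: algebra_simps)
  qed
  then have "int i - 1 - m > 0" using p by (simp add: zero_less_mult_iff)
  \<comment> \<open>\<open>e\<close> is the surplus of the exponent \<open>j - 1\<close> in
    \<open>K(1)\<close> over the exponent \<open>d - i\<close> of the trivial estimate.\<close>
  then obtain e where e: "int i - 1 = int e + m"
    by (intro that[of "nat (int i - 1 - m)"]) simp
  then have j_eq: "j = Suc (d - i + e)" using i by (simp add: m_def)
  have less: "p * (t + (p + 1) * m) < t + 2 * p * (int e + m)"
    using less e by simp
  show ?thesis
  proof (cases "int d \<le> p ^ e * t")
    case True
    then show ?thesis using abs_krawtchouk_le_final[OF q j t i(2) j_eq] by (simp add: p_def)
  next
    case False
    then have "p = 2"
      using power_dominates_large_base[of p t m e] p t m less d by linarith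
    then have "q = 3" by (simp add: p_def)
    have "2 * (t + 3 * m) < t + 4 * (int e + m)" "\<not> t + 3 * m \<le> 2 ^ e * t"
      using less False d unfolding \<open>p = 2\<close> by simp_all
    then have "t = 1 \<and> m \<le> 7 \<or> t = 2 \<and> (m = 1 \<or> m = 2)"
      using power_dominates_base_2[of t m e] t(2) m by blast
    then have "t = 1 \<and> (m = 0 \<or> m = 1 \<or> m = 2 \<or> m = 3 \<or> m = 4 \<or> m = 5 \<or> m = 6 \<or> m = 7)
        \<or> t = 2 \<and> (m = 1 \<or> m = 2)" using m by presburger
    moreover have "int d = t + 3 * m" "int j = t + 2 * m"
      using d unfolding \<open>p = 2\<close> by (simp_all add: m_def)
    ultimately have "(d, j) \<in> {(1,1),(4,3),(7,5),(10,7),(13,9),(16,11),(19,13),(22,15),(5,4),(8,6)}"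
      by (elim disjE conjE; simp)
    then show ?thesis
      using krawtchouk_ternary_small_cases[of d j i] i exc unfolding \<open>q = 3\<close> by blast
  qed
qed

theorem theorem1p4:
  fixes q d j :: nat
  assumes "q \<ge> 3" and "d \<ge> 1"
    and "real d - (real d - 1) / real q \<le> real j" and "j \<le> d"
  shows "(\<forall>i::nat. i \<le> d \<longrightarrow> krawtchouk q d j 1 \<le> krawtchouk q d j i) \<and>
         (\<forall>i::nat. 1 \<le> i \<and> i \<le> d \<and> (q, d, i, j) \<noteq> (3, 4, 3, 3) \<longrightarrow>
            \<bar>krawtchouk q d j i\<bar> \<le> \<bar>krawtchouk q d j 1\<bar>)"
proof -
  define t where "t = int q * int j - (int q - 1) * int d"
  \<comment> \<open>Clearing the denominator turns the hypothesis on \<open>j\<close> into the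
    integer inequality \<open>t \<ge> 1\<close>.\<close>
  have "real q * (real d - (real d - 1) / real q) \<le> real q * real j"
    using assms by (intro mult_left_mono) auto
  also have "real q * (real d - (real d - 1) / real q) = real q * real d - (real d - 1)"
    using assms(1) by (simp add: field_simps)
  finally have "real_of_int (int q * int d - (int d - 1)) \<le> real_of_int (int q * int j)"
    by simp
  then have "t \<ge> 1" unfolding of_int_le_iff t_def by (simp add: algebra_simps)
  note bound = abs_krawtchouk_le[OF assms(1,4) t_def this]
  have pos: "krawtchouk q d j 0 > 0" using assms by (intro krawtchouk_at_0_pos) auto
  have "(int q - 1) * int d * krawtchouk q d j 1 = - t * krawtchouk q d j 0"
    using krawtchouk_1_eq[of d q j] assms(2) by (simp add: t_def)
  then have "(int q - 1) * int d * krawtchouk q d j 1 < 0" using pos \<open>t \<ge> 1\<close> by simp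
  moreover have "(int q - 1) * int d > 0" using assms by simp
  ultimately have neg: "krawtchouk q d j 1 < 0"
    using mult_less_cancel_left_pos[of "(int q - 1) * int d" "krawtchouk q d j 1" 0]
    by (simp only: mult_zero_right)
  \<comment> \<open>As \<open>K(1) < 0\<close>, the absolute bound gives
    \<open>K(1) = - \<bar>K(1)\<bar> \<le> K(i)\<close>. What remains is \<open>K(0) > 0\<close> and
    the exceptional case, where \<open>K(3) = 5\<close> and \<open>K(1) = - 4\<close>.\<close>
  have "krawtchouk q d j 1 \<le> krawtchouk q d j i" if "i \<le> d" for i
  proof -
    consider "i = 0" | "(q, d, i, j) = (3, 4, 3, 3)" | "1 \<le> i" "(q, d, i, j) \<noteq> (3, 4, 3, 3)"
      by (cases i) auto
    then show ?thesis
    proof cases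
      case 2
      then show ?thesis by (simp add: krawtchouk_def numeral_eq_Suc)
    next
      case 3
      then show ?thesis using bound[OF 3(1) that 3(2)] neg by linarith
    qed (use pos neg in auto)
  qed
  then show ?thesis using bound by blast
qed

end
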